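(* Let $M\ge 1$ be an integer, $0<p<1$ and $P>1$. For each integer $K$ with $1\le K\le M$, let $\overline{R}_{\mathrm{net}}=\overline{R}_{\mathrm{net}}(K,N)$ be the average net rate (in bits per channel use) of the proposed scheme with parameter $K$ and block length $N$, where the number $D$ of message bits is determined by $N$. Then, as $D\to\infty$ (equivalently $N\to\infty$), $$\max_{1\le K\le M}\ \lim_{D\to\infty}\overline{R}_{\mathrm{net}}=\frac12\log_2^+(P).$$
   Context: $\log_2^+(x)=\log_2 x$ if $x\ge1$ and $0$ otherwise. Generalized tree-splitting protocol with parameter $K\ge1$. Let $T(L)$ be the random number of slots used to resolve a group of $L\ge 0$ users. If $L=0$, exactly one (empty) slot is used. If $1\le L\le K$, exactly $L$ slots are used. If $L>K$, one slot is used (a collision), after which each of the $L$ users independently joins group 1 or group 2 with probability $1/2$ each; then group 1 is resolved by a fresh run of the same protocol (with independent randomness), and afterwards group 2 is resolved by a fresh run of the same protocol (this also applies to empty groups). $T(L)$ is the total number of slots, and $S(L)=\mathbb{E}[T(L)]$. User activity: there are $M$ users, each independently active with probability $p$; $q(L)=\binom{M}{L}p^L(1-p)^{M-L}$, $q_0=(1-p)^M$, $\hat q(L)=q(L)/(1-q_0)$ for $L\ge 1$. Net rate: a slot consists of $N$ channel uses. The slot carries a signature of $N_w$ symbols over an alphabet of size $q=N\log_2 N$ (treated as a real parameter) together with a message of $D$ bits, at total rate $\frac12\log_2^+(P)$ bits per channel use (finite block length effects are ignored), where $$N_w=\left\lceil\frac{K\log_2 M}{\log_2(N\log_2 N-1)-\log_2K}\right\rceil+1,\qquad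 D=\frac N2\log_2^+(P)-N_w\log_2(N\log_2N),$$ for $N$ large enough that these are well defined. With $R_{\mathrm{net}}(L)=\frac{LD}{S(L)N}$, the average net rate is $$\overline{R}_{\mathrm{net}}=\sum_{L=1}^M R_{\mathrm{net}}(L)\,\hat q(L)=\frac DN\sum_{L=1}^M\frac{L}{S(L)}\hat q(L).$$ *)

theory Defs
  imports "HOL-Probability.Probability"
begin

definition log2_plus :: "real \<Rightarrow> real" where
  "log2_plus x = (if x \<ge> 1 then log 2 x else 0)"

text \<open>
  Law of the number \<open>T(L)\<close> of slots used by the splitting protocol on \<open>L\<close> users. A split may leave
  all users in one group, so the recursion is not well-founded; it is taken as the least fixed point
  in the subprobability mass functions, the missing mass being the probability that the protocol
  never stops. For \<open>K \<ge> 1\<close> it stops almost surely, with finite expectation. The number of users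
  joining group 1 is the number of heads among \<open>L\<close> independent fair coins.
\<close>
partial_function (spmf) slots :: "nat \<Rightarrow> nat \<Rightarrow> nat spmf" where
  "slots K L =
    (if L = 0 then return_spmf 1
     else if L \<le> K then return_spmf L
     else bind_spmf (spmf_of_pmf (binomial_pmf L (1/2))) (\<lambda>i.
            bind_spmf (slots K i) (\<lambda>t1.
              bind_spmf (slots K (L - i)) (\<lambda>t2.
                return_spmf (1 + t1 + t2)))))"

definition expected_slots :: "nat \<Rightarrow> nat \<Rightarrow> real" where
  "expected_slots K L = (LINT t|measure_spmf (slots K L). real t)"

definition activity_prob :: "nat \<Rightarrow> real \<Rightarrow> nat \<Rightarrow> real" where
  "activity_prob M p L = real (M choose L) * p ^ L * (1 - p) ^ (M - L)"

text \<open>The law of the number of active users, conditioned on there being at least one.\<close>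
definition cond_activity_prob :: "nat \<Rightarrow> real \<Rightarrow> nat \<Rightarrow> real" where
  "cond_activity_prob M p L = activity_prob M p L / (1 - (1 - p) ^ M)"

text \<open>
  The alphabet size \<open>N log\<^sub>2 N\<close> is a real number, and so is the number of message bits. For the
  finitely many \<open>N\<close> with \<open>N log\<^sub>2 N - 1 \<le> K\<close> the following values carry no meaning.
\<close>
definition signature_length :: "nat \<Rightarrow> nat \<Rightarrow> nat \<Rightarrow> int" where
  "signature_length M K N =
     \<lceil>real K * log 2 (real M) / (log 2 (real N * log 2 (real N) - 1) - log 2 (real K))\<rceil> + 1"

definition message_bits :: "nat \<Rightarrow> real \<Rightarrow> nat \<Rightarrow> nat \<Rightarrow> real" where
  "message_bits M P K N =
     real N / 2 * log2_plus P
       - real_of_int (signature_length M K N) * log 2 (real N * log 2 (real N))"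

definition net_rate :: "nat \<Rightarrow> real \<Rightarrow> nat \<Rightarrow> nat \<Rightarrow> nat \<Rightarrow> real" where
  "net_rate M P K N L = real L * message_bits M P K N / (expected_slots K L * real N)"

definition avg_net_rate :: "nat \<Rightarrow> real \<Rightarrow> real \<Rightarrow> nat \<Rightarrow> nat \<Rightarrow> real" where
  "avg_net_rate M p P K N = (\<Sum>L=1..M. net_rate M P K N L * cond_activity_prob M p L)"

text \<open>The filter on block lengths \<open>N\<close> expressing \<open>D \<rightarrow> \<infinity>\<close>, where \<open>D\<close> is a function of \<open>N\<close>.\<close>
definition message_bits_to_infinity :: "nat \<Rightarrow> real \<Rightarrow> nat \<Rightarrow> nat filter" where
  "message_bits_to_infinity M P K = filtercomap (message_bits M P K) at_top"

end

theory Submission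
  imports Defs "HOL-Real_Asymp.Real_Asymp"
begin

text \<open>
  The signature has bounded length for large \<open>N\<close>, so it costs \<open>O(log N)\<close> of the \<open>N\<close> channel uses
  and \<open>D / N\<close> tends to \<open>1/2 log\<^sub>2\<^sup>+ P\<close>. The limiting average rate is therefore that constant times
  the mean of \<open>L / S(L)\<close>. Every user needs a slot of its own, hence \<open>S(L) \<ge> L\<close> and the mean is at
  most 1; for \<open>K = M\<close> no collision ever occurs, hence \<open>S(L) = L\<close> and the mean is exactly 1.
\<close>

section \<open>The number of slots\<close>

text \<open>By fixed-point induction: the approximation that never stops has empty support, and
  after a collision the two groups already use as many slots as they have users.\<close>

lemma slots_ge: "t \<in> set_spmf (slots K L) \<Longrightarrow> L \<le> t"
proof -
  have "\<forall>t\<in>set_spmf (slots K L). L \<le> t" for K L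
  proof (induction arbitrary: K L rule: slots.fixp_induct)
    case (3 slots')
    have "L \<le> Suc (t1 + t2)"
      \<comment> \<open>Nothing bounds \<open>i\<close> by \<open>L\<close> here, but truncated
        subtraction still gives \<open>L \<le> i + (L - i)\<close>.\<close>
      if "t1 \<in> set_spmf (slots' K i)" "t2 \<in> set_spmf (slots' K (L - i))" for i t1 t2
    proof -
      have "i \<le> t1" "L - i \<le> t2"
        using 3 that by blast+
      then show ?thesis
        by linarith
    qed
    then show ?case
      by (auto simp: set_bind_spmf bind_UNION simp del: bind_spmf_of_pmf)
  qed simp_all
  then show "t \<in> set_spmf (slots K L) \<Longrightarrow> L \<le> t"
    by blast
qed

lemma slots_0: "slots K 0 = return_spmf 1"
  by (subst slots.simps) simp

lemma slots_le: "L \<ge> 1 \<Longrightarrow> L \<le> K \<Longrightarrow> slots K L = return_spmf L"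
  by (subst slots.simps) simp

text \<open>The weight is the probability of stopping. Given the split, the groups run
  independently, so their stopping probabilities multiply.\<close>

lemma weight_slots_split:
  assumes "K < L"
  shows "weight_spmf (slots K L) =
    (\<Sum>i\<le>L. weight_spmf (slots K i) * weight_spmf (slots K (L - i)) * (real (L choose i) / 2 ^ L))"
proof -
  have eq: "slots K L = bind_spmf (spmf_of_pmf (binomial_pmf L (1/2))) (\<lambda>i.
      bind_spmf (slots K i) (\<lambda>t1. bind_spmf (slots K (L - i)) (\<lambda>t2. return_spmf (1 + t1 + t2))))"
    using assms by (subst slots.simps) simp
  have "weight_spmf (slots K L) = measure_pmf.expectation (binomial_pmf L (1/2))
      (\<lambda>i. weight_spmf (slots K i) * weight_spmf (slots K (L - i)))"
    unfolding eq by (simp add: weight_bind_spmf o_def del: bind_spmf_of_pmf)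
  also have "\<dots> = (\<Sum>i\<le>L. weight_spmf (slots K i) * weight_spmf (slots K (L - i))
      * pmf (binomial_pmf L (1/2)) i)"
    by (rule integral_measure_pmf_real) (auto simp: set_pmf_binomial_eq)
  also have "\<dots> = (\<Sum>i\<le>L. weight_spmf (slots K i) * weight_spmf (slots K (L - i))
      * (real (L choose i) / 2 ^ L))"
    by (rule sum.cong) (auto simp: power_add [symmetric] power_divide)
  finally show ?thesis .
qed

text \<open>
  In the recursion for the weights, only the two splits that leave one group empty refer back to
  \<open>L\<close> itself; their total probability \<open>2 / 2\<^sup>L\<close> is below 1, so the missing mass at \<open>L\<close> vanishes.
\<close>
lemma weight_slots:
  assumes "K \<ge> 1"
  shows "weight_spmf (slots K L) = 1"
proof (induction L rule: less_induct)
  case (less L)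
  show ?case
  proof (cases "L \<le> K")
    case True
    then show ?thesis
      by (cases "L = 0") (simp_all add: slots_0 slots_le)
  next
    case False
    with assms have L: "K < L" "L \<ge> 2" by auto
    define a where "a = weight_spmf (slots K L)"
    define f where "f i = weight_spmf (slots K i) * weight_spmf (slots K (L - i))" for i
    have w0: "weight_spmf (slots K 0) = 1"
      by (simp add: slots_0)
    have f: "f i = (if i = 0 \<or> i = L then a else 1)" if "i \<le> L" for i
      using that less w0 by (auto simp: f_def a_def)
    have total: "(\<Sum>i\<le>L. real (L choose i) / 2 ^ L) = 1"
    proof -
      have "(\<Sum>i\<le>L. real (L choose i)) = 2 ^ L"
        using choose_row_sum[of L] by (metis of_nat_sum of_nat_numeral of_nat_power)
      then show ?thesis
        by (simp flip: sum_divide_distrib)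
    qed
    \<comment> \<open>Subtracting the recursion from \<open>total\<close> leaves an average of
      missing masses, in which every split into two nonempty groups contributes 0.\<close>
    have "1 - a = (\<Sum>i\<le>L. (1 - f i) * (real (L choose i) / 2 ^ L))"
      using weight_slots_split[OF L(1)] total
      by (simp add: a_def f_def left_diff_distrib sum_subtractf del: times_divide_eq_right)
    also have "\<dots> = (\<Sum>i\<in>{0, L}. (1 - f i) * (real (L choose i) / 2 ^ L))"
      by (rule sum.mono_neutral_right) (auto simp: f)
    also have "\<dots> = (1 - a) * (2 / 2 ^ L)"
      using L by (simp add: f field_simps)
    finally have eq: "1 - a = (1 - a) * (2 / 2 ^ L)" .
    \<comment> \<open>Here \<open>L \<ge> 2\<close> matters: at \<open>L = 1\<close> the factor
      would be 1 and the equation would say nothing about \<open>a\<close>.\<close>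
    have "(2::real) ^ 2 \<le> 2 ^ L"
      using L by (intro power_increasing) auto
    then have "(2::real) / 2 ^ L \<noteq> 1"
      by simp
    with eq have "1 - a = 0"
      by (metis mult_cancel_left1)
    then show ?thesis
      by (simp add: a_def)
  qed
qed

lemma expected_slots_le:
  assumes "L \<ge> 1" "L \<le> K"
  shows "expected_slots K L = real L"
  using assms
  by (simp add: expected_slots_def slots_le measure_spmf_return_spmf integral_return)

text \<open>
  The bound holds whether or not the expectation is finite: a divergent integral is 0, and so is
  the quotient by it.
\<close>
lemma users_per_slot_le_1:
  assumes "K \<ge> 1"
  shows "real L / expected_slots K L \<le> 1"
proof (cases "integrable (measure_spmf (slots K L)) real")
  case True
  \<comment> \<open>Almost sure termination enters here: a constant integrates to itself only under
    total mass 1.\<close>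
  have "real L = (LINT t|measure_spmf (slots K L). real L)"
    using weight_slots[OF assms] by (simp add: weight_spmf_def)
  also have "\<dots> \<le> expected_slots K L"
    unfolding expected_slots_def
    using True by (intro integral_mono_AE) (auto simp: AE_measure_spmf_iff slots_ge)
  finally show ?thesis
    by (cases "L = 0") (auto simp: divide_le_eq_1)
next
  case False
  then show ?thesis
    by (simp add: expected_slots_def not_integrable_integral_eq)
qed

section \<open>The user activity\<close>

lemma cond_activity_prob_nonneg:
  assumes "0 \<le> p" "p \<le> 1"
  shows "0 \<le> cond_activity_prob M p L"
  using assms by (simp add: cond_activity_prob_def activity_prob_def power_le_one)

text \<open>By the binomial theorem; the missing term \<open>L = 0\<close> is
  \<open>(1 - p) ^ M\<close>, which is below 1 because \<open>p > 0\<close>.\<close>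

lemma sum_cond_activity_prob:
  assumes "M \<ge> 1" "0 < p" "p \<le> 1"
  shows "(\<Sum>L=1..M. cond_activity_prob M p L) = 1"
proof -
  have "(\<Sum>L\<le>M. activity_prob M p L) = 1"
    using binomial_ring[of p "1 - p" M] by (simp add: activity_prob_def)
  moreover have "(\<Sum>L\<le>M. activity_prob M p L) = (1 - p) ^ M + (\<Sum>L=1..M. activity_prob M p L)"
    by (simp add: sum.atMost_shift sum.atLeast1_atMost_eq activity_prob_def lessThan_Suc_atMost)
  moreover have "(1 - p) ^ M < 1"
    using assms power_decreasing[of 1 M "1 - p"] by simp
  ultimately show ?thesis
    by (simp add: cond_activity_prob_def flip: sum_divide_distrib)
qed

section \<open>The message length\<close>

text \<open>The denominator diverges while the numerator is fixed, so the quotient ends up in the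
  unit interval and its ceiling is 0 or 1.\<close>

lemma eventually_signature_length_bounds:
  assumes "M \<ge> 1" "K \<ge> 1"
  shows "\<forall>\<^sub>F N in sequentially. signature_length M K N \<in> {1..2}"
proof -
  define g where "g N = log 2 (real N * log 2 (real N) - 1) - log 2 (real K)" for N :: nat
  have "filterlim g at_top sequentially"
    unfolding g_def using assms(2) by real_asymp
  \<comment> \<open>The bound 1 makes the denominator positive; the other bound makes the quotient
    at most 1.\<close>
  then have "\<forall>\<^sub>F N in sequentially. g N \<ge> max 1 (real K * log 2 (real M))"
    by (rule filterlim_at_top[THEN iffD1, THEN spec])
  then show ?thesis
  proof eventually_elim
    case (elim N)
    have "0 \<le> real K * log 2 (real M)"
      using assms by simp
    with elim have "0 \<le> real K * log 2 (real M) / g N" "real K * log 2 (real M) / g N \<le> 1"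
      by (auto simp: divide_le_eq_1)
    then have "0 \<le> \<lceil>real K * log 2 (real M) / g N\<rceil>" "\<lceil>real K * log 2 (real M) / g N\<rceil> \<le> 1"
      by (auto simp: ceiling_le_iff le_ceiling_iff)
    then show ?case
      by (simp add: signature_length_def g_def)
  qed
qed

lemma message_bits_rate_tendsto:
  assumes "M \<ge> 1" "K \<ge> 1"
  shows "(\<lambda>N. message_bits M P K N / real N) \<longlonglongrightarrow> 1 / 2 * log2_plus P"
proof -
  define s where "s N = real_of_int (signature_length M K N)" for N
  define g where "g N = log 2 (real N * log 2 (real N)) / real N" for N :: nat
  have g: "g \<longlonglongrightarrow> 0"
    unfolding g_def by real_asymp
  have "(\<lambda>N. s N * g N) \<longlonglongrightarrow> 0"
  proof (rule Lim_null_comparison)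
    show "\<forall>\<^sub>F N in sequentially. norm (s N * g N) \<le> 2 * \<bar>g N\<bar>"
      using eventually_signature_length_bounds[OF assms]
      by eventually_elim (auto simp: s_def abs_mult intro!: mult_right_mono)
    show "(\<lambda>N. 2 * \<bar>g N\<bar>) \<longlonglongrightarrow> 0"
      using tendsto_mult_right_zero[OF tendsto_rabs_zero[OF g]] .
  qed
  from tendsto_diff[OF tendsto_const this]
  have "(\<lambda>N. 1 / 2 * log2_plus P - s N * g N) \<longlonglongrightarrow> 1 / 2 * log2_plus P"
    by simp
  moreover have "\<forall>\<^sub>F N in sequentially.
      1 / 2 * log2_plus P - s N * g N = message_bits M P K N / real N"
    using eventually_gt_at_top[of 0]
    by eventually_elim (simp add: message_bits_def s_def g_def field_simps)
  ultimately show ?thesis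
    by (rule Lim_transform_eventually)
qed

text \<open>Monotonicity of \<open>f\<close> is not assumed: a value above the maximum of
  \<open>f\<close> on \<open>{..n}\<close> can only occur at an index beyond
  \<open>n\<close>.\<close>

lemma filtercomap_at_top_eq_sequentially:
  fixes f :: "nat \<Rightarrow> 'a :: {linorder, no_top}"
  assumes "filterlim f at_top sequentially"
  shows "filtercomap f at_top = sequentially"
proof (rule antisym)
  show "sequentially \<le> filtercomap f at_top"
    using assms by (simp add: filterlim_iff_le_filtercomap)
  show "filtercomap f at_top \<le> sequentially"
  proof (rule filter_leI)
    fix Q assume "eventually Q sequentially"
    then obtain n where n: "\<And>N. N \<ge> n \<Longrightarrow> Q N"
      by (auto simp: eventually_sequentially)
    have "Q N" if "f N > Max (f ` {..n})" for N
    proof (rule n, rule ccontr)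
      assume "\<not> n \<le> N"
      then have "f N \<le> Max (f ` {..n})"
        by (intro Max_ge) auto
      with that show False by order
    qed
    then show "eventually Q (filtercomap f at_top)"
      using eventually_gt_at_top[of "Max (f ` {..n})"]
      unfolding eventually_filtercomap by blast
  qed
qed

text \<open>This makes the two readings of the limit agree. Since \<open>P > 1\<close>, the ratio of
  message bits to \<open>N\<close> has a positive limit, so the message bits grow without
  bound.\<close>

lemma message_bits_to_infinity_eq:
  assumes "M \<ge> 1" "K \<ge> 1" "P > 1"
  shows "message_bits_to_infinity M P K = sequentially"
  unfolding message_bits_to_infinity_def
proof (rule filtercomap_at_top_eq_sequentially)
  have "0 < 1 / 2 * log2_plus P"
    using assms by (simp add: log2_plus_def)
  from filterlim_tendsto_pos_mult_at_top[OF message_bits_rate_tendsto[OF assms(1,2)] this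
      filterlim_real_sequentially]
  have "filterlim (\<lambda>N. message_bits M P K N / real N * real N) at_top sequentially" .
  moreover have "\<forall>\<^sub>F N in sequentially.
      message_bits M P K N / real N * real N = message_bits M P K N"
    using eventually_gt_at_top[of 0] by eventually_elim simp
  ultimately show "filterlim (message_bits M P K) at_top sequentially"
    by (simp cong: filterlim_cong)
qed

section \<open>The average net rate\<close>

lemma avg_net_rate_tendsto:
  assumes "M \<ge> 1" "K \<ge> 1"
  shows "avg_net_rate M p P K \<longlonglongrightarrow>
    1 / 2 * log2_plus P * (\<Sum>L=1..M. real L / expected_slots K L * cond_activity_prob M p L)"
proof -
  \<comment> \<open>The common factor leaves the sum for every \<open>N\<close>; at
    \<open>N = 0\<close> both sides are 0, as division by zero yields 0.\<close>
  have "avg_net_rate M p P K = (\<lambda>N. message_bits M P K N / real N *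
      (\<Sum>L=1..M. real L / expected_slots K L * cond_activity_prob M p L))"
    by (rule ext) (simp add: avg_net_rate_def net_rate_def sum_distrib_left mult_ac)
  then show ?thesis
    by (simp only: tendsto_mult_right message_bits_rate_tendsto[OF assms])
qed

theorem theorem6:
  fixes M :: nat and p P :: real
  assumes "M \<ge> 1" and "0 < p" and "p < 1" and "P > 1"
  shows "(\<forall>K\<in>{1..M}. message_bits_to_infinity M P K = sequentially) \<and>
    (\<forall>K\<in>{1..M}. \<exists>l. (avg_net_rate M p P K \<longlongrightarrow> l) (message_bits_to_infinity M P K)) \<and>
    Max ((\<lambda>K. Lim (message_bits_to_infinity M P K) (avg_net_rate M p P K)) ` {1..M})
      = 1 / 2 * log2_plus P"
proof -
  define c where "c = 1 / 2 * log2_plus P"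
  define r where "r K = (\<Sum>L=1..M. real L / expected_slots K L * cond_activity_prob M p L)" for K
  have filter_eq: "message_bits_to_infinity M P K = sequentially" if "K \<in> {1..M}" for K
    using that assms by (intro message_bits_to_infinity_eq) auto
  have lim: "(avg_net_rate M p P K \<longlongrightarrow> c * r K) (message_bits_to_infinity M P K)"
    if "K \<in> {1..M}" for K
    using that assms avg_net_rate_tendsto[of M K p P] by (simp add: filter_eq c_def r_def)
  \<comment> \<open>\<open>Lim\<close> is a definite description, so the filter must be nontrivial
    for the limit to be unique; \<open>filter_eq\<close> provides this.\<close>
  have Lim_eq: "Lim (message_bits_to_infinity M P K) (avg_net_rate M p P K) = c * r K"
    if "K \<in> {1..M}" for K
    using lim[OF that] by (intro tendsto_Lim) (simp_all add: filter_eq[OF that])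
  have c: "c \<ge> 0"
    using assms by (simp add: c_def log2_plus_def)
  have sum1: "(\<Sum>L=1..M. cond_activity_prob M p L) = 1"
    using assms by (intro sum_cond_activity_prob) auto
  have "r K \<le> (\<Sum>L=1..M. 1 * cond_activity_prob M p L)" if "K \<in> {1..M}" for K
    unfolding r_def using that assms
    by (intro sum_mono mult_right_mono users_per_slot_le_1 cond_activity_prob_nonneg) auto
  with sum1 have upper: "r K \<le> 1" if "K \<in> {1..M}" for K
    using that by simp
  have "r M = (\<Sum>L=1..M. cond_activity_prob M p L)"
    unfolding r_def by (rule sum.cong) (auto simp: expected_slots_le)
  with sum1 have attained: "r M = 1"
    by simp
  have "Max ((\<lambda>K. Lim (message_bits_to_infinity M P K) (avg_net_rate M p P K)) ` {1..M}) = c"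
  proof (rule Max_eqI)
    show "y \<le> c" if "y \<in> (\<lambda>K. Lim (message_bits_to_infinity M P K) (avg_net_rate M p P K)) ` {1..M}" for y
      using that upper c by (auto simp: Lim_eq mult_left_le)
    show "c \<in> (\<lambda>K. Lim (message_bits_to_infinity M P K) (avg_net_rate M p P K)) ` {1..M}"
      using assms attained by (intro image_eqI[of _ _ M]) (auto simp: Lim_eq)
  qed simp
  then show ?thesis
    using filter_eq lim unfolding c_def by blast
qed

end
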